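(* Let $n,k$ be positive integers with $n\geq 2k$, and let $\mathcal{M}$ be an intersecting collection of $k$-multisets on $[n]$. Then $$|\mathcal{M}|\leq\binom{n+k-2}{k-1}.$$ Equality is attainable, and it occurs if and only if $\mathcal{M}$ is a trivial collection.
   Context: $[n]=\{1,2,\ldots,n\}$. A $k$-multiset on $[n]$ is a multiset of $k$ elements (counted with multiplicity) of $[n]$. A collection $\mathcal{M}$ of distinct $k$-multisets is intersecting if every pair of multisets in $\mathcal{M}$ has at least one element in common. A trivial collection is a collection consisting of all $k$-multisets on $[n]$ that contain $x$ (with multiplicity at least one), for some fixed element $x\in[n]$. *)

theory Defs
  imports "HOL-Library.Multiset"
begin

definition k_multisets :: "nat \<Rightarrow> nat \<Rightarrow> nat multiset set" where
  "k_multisets n k = {A. set_mset A \<subseteq> {1..n} \<and> size A = k}"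

definition intersecting :: "'a multiset set \<Rightarrow> bool" where
  "intersecting \<M> \<longleftrightarrow> (\<forall>A\<in>\<M>. \<forall>B\<in>\<M>. A \<inter># B \<noteq> {#})"

definition trivial_collection :: "nat \<Rightarrow> nat \<Rightarrow> nat multiset set \<Rightarrow> bool" where
  "trivial_collection n k \<M> \<longleftrightarrow> (\<exists>x\<in>{1..n}. \<M> = {A \<in> k_multisets n k. x \<in># A})"

end

theory Submission
  imports Defs "HOL-Combinatorics.Multiset_Permutations"
begin

text \<open>For \<open>S \<subseteq> {1..n}\<close> there are as many \<open>k\<close>-multisets with support \<open>S\<close> as \<open>k\<close>-subsets of
  \<open>{1..n + k - 1}\<close> with trace \<open>S\<close> on \<open>{1..n}\<close>. So supports can be matched with traces, and an
  intersecting collection of multisets becomes an intersecting family of \<open>k\<close>-subsets of a ground set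
  of size at least \<open>3 * k - 1\<close>. For these, Katona's cycle argument gives the bound. If it is attained,
  then in every cyclic order the members of the family among the arcs are the \<open>k\<close> arcs through one
  point; exchanging single elements then shows that the family is a star.\<close>

section \<open>Arcs of a cyclic order\<close>

text \<open>A list stands for a cyclic order, so an arc may run past its end. Rotations count as
  different orders, which affects all \<open>k\<close>-sets alike in the double count.\<close>

definition arc :: "nat \<Rightarrow> 'a list \<Rightarrow> nat \<Rightarrow> 'a set" where
  "arc k xs i = (\<lambda>t. xs ! ((i + t) mod length xs)) ` {..<k}"

text \<open>Reads off an arc that does not wrap around in an order written as a
  concatenation.\<close>

lemma arc_append:
  assumes "length ps = i" "length qs = k"
  shows "arc k (ps @ qs @ rs) i = set qs"
proof -
  have "arc k (ps @ qs @ rs) i = (!) qs ` {..<k}"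
    unfolding arc_def using assms by (intro image_cong) (auto simp: nth_append)
  also have "\<dots> = set qs"
    using assms nth_image[of k qs] by (simp add: lessThan_atLeast0)
  finally show ?thesis .
qed

lemma arc_map: "xs \<noteq> [] \<Longrightarrow> arc k (map p xs) i = p ` arc k xs i"
  by (auto simp: arc_def image_image)

lemma arc_subset: "xs \<noteq> [] \<Longrightarrow> arc k xs i \<subseteq> set xs"
  by (auto simp: arc_def)

text \<open>The modulus divides the difference, which is too small to be a nonzero multiple. This
  turns congruences between positions into equations.\<close>

lemma eq_if_mod_eq:
  fixes x y m :: nat
  assumes "x mod m = y mod m" "x < y + m" "y < x + m"
  shows "x = y"
proof (rule ccontr)
  assume "x \<noteq> y"
  moreover have "m dvd (max x y - min x y)"
    using assms(1) by (metis max_def min_def mod_eq_dvd_iff_nat nle_le)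
  ultimately show False
    using assms(2,3) by (auto dest!: dvd_imp_le simp: max_def min_def split: if_splits)
qed

lemma card_arc:
  assumes "distinct xs" "k \<le> length xs" "xs \<noteq> []"
  shows "card (arc k xs i) = k"
proof -
  have "inj_on (\<lambda>t. xs ! ((i + t) mod length xs)) {..<k}"
  proof (rule inj_onI)
    fix s t assume st: "s \<in> {..<k}" "t \<in> {..<k}"
      and "xs ! ((i + s) mod length xs) = xs ! ((i + t) mod length xs)"
    then have "(i + s) mod length xs = (i + t) mod length xs"
      using assms by (simp add: nth_eq_iff_index_eq)
    then have "i + s = i + t"
      by (rule eq_if_mod_eq) (use st assms in auto)
    then show "s = t" by simp
  qed
  then show ?thesis by (simp add: arc_def card_image)
qed

text \<open>Since \<open>m \<ge> 3 * k - 1\<close>, the starting points of pairwise meeting arcs cannot wrap around the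
  cycle, so they all lie in a window of length \<open>k\<close>.\<close>

lemma cyclic_window:
  fixes I :: "nat set" and k m :: nat
  assumes I: "I \<subseteq> {..<m}" and k: "k > 0" and m: "3 * k \<le> m + 1"
    and meet: "\<And>i j. i \<in> I \<Longrightarrow> j \<in> I \<Longrightarrow> \<exists>s<k. \<exists>t<k. (i + s) mod m = (j + t) mod m"
  shows "card I \<le> k" and "card I = k \<Longrightarrow> \<exists>a. I = (\<lambda>t. (a + t) mod m) ` {..<k}"
proof -
  have "card I \<le> k \<and> (card I = k \<longrightarrow> (\<exists>a. I = (\<lambda>t. (a + t) mod m) ` {..<k}))"
  proof (cases "I = {}")
    case True
    then show ?thesis using k by auto
  next
    case False
    then obtain j where j: "j \<in> I" by auto
    \<comment> \<open>\<open>c\<close> is the position \<open>k - 1\<close> before \<open>j\<close>,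
      raised by \<open>m\<close> to avoid truncated subtraction. An arc meeting the one at
      \<open>j\<close> starts, modulo \<open>m\<close>, at one of the \<open>2 * k - 1\<close>
      positions from \<open>c\<close> on.\<close>
    define c where "c = j + (m + 1 - k)"
    define T where "T = {t. t \<le> 2 * k - 2 \<and> (c + t) mod m \<in> I}"
    have finT: "finite T" unfolding T_def by simp
    have "I \<subseteq> (\<lambda>t. (c + t) mod m) ` T"
    proof
      fix i assume i: "i \<in> I"
      obtain s t where st: "s < k" "t < k" "(i + s) mod m = (j + t) mod m"
        using meet[OF i j] by auto
      define u where "u = t + (k - 1) - s"
      have "(c + u + s) mod m = (j + t + m) mod m"
        by (rule arg_cong[where f = "\<lambda>z. z mod m"]) (use st k m in \<open>simp add: c_def u_def\<close>)
      then have "(c + u + s) mod m = (i + s) mod m" using st(3) by simp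
      then have "(c + u) mod m = i mod m"
        by (auto simp: nat_mod_eq_iff ac_simps)
      moreover have "i mod m = i" using i I by auto
      moreover have "u \<le> 2 * k - 2" using st unfolding u_def by auto
      ultimately show "i \<in> (\<lambda>t. (c + t) mod m) ` T"
        using i unfolding T_def by (intro image_eqI[of _ _ u]) auto
    qed
    then have IT: "I = (\<lambda>t. (c + t) mod m) ` T" by (auto simp: T_def)
    have T0: "T \<noteq> {}" using IT False by auto
    \<comment> \<open>Offsets in \<open>T\<close> differ by at most \<open>2 * k - 2\<close> and
      places within an arc by at most \<open>k - 1\<close>. The sum is below \<open>m\<close>, so a
      common point gives an equation and not only a congruence, and the offsets differ by less than
      \<open>k\<close>.\<close>
    have win: "T \<subseteq> {Min T..<Min T + k}"
    proof
      fix t assume t: "t \<in> T"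
      define u where "u = Min T"
      have u: "u \<in> T" "u \<le> t" using finT T0 t by (auto simp: u_def)
      obtain s s' where ss: "s < k" "s' < k" "((c + u) mod m + s) mod m = ((c + t) mod m + s') mod m"
        using meet[of "(c + u) mod m" "(c + t) mod m"] t u unfolding T_def by auto
      from ss(3) have "(c + u + s) mod m = (c + t + s') mod m"
        by (simp add: mod_add_left_eq)
      then have "c + u + s = c + t + s'"
        by (rule eq_if_mod_eq) (use ss t u m in \<open>auto simp: T_def\<close>)
      then show "t \<in> {Min T..<Min T + k}" using ss u unfolding u_def by auto
    qed
    have "card I \<le> card T" unfolding IT using finT by (rule card_image_le)
    moreover have "card T \<le> k" using card_mono[OF _ win] by simp
    \<comment> \<open>Since \<open>card I \<le> card T \<le> k\<close>, the assumption
      \<open>card I = k\<close> forces \<open>card T = k\<close>, and then \<open>T\<close> fills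
      its window.\<close>
    moreover have "\<exists>a. I = (\<lambda>t. (a + t) mod m) ` {..<k}" if "card T = k"
    proof -
      have "T = {Min T..<Min T + k}" using win that by (intro card_subset_eq) auto
      also have "\<dots> = (\<lambda>t. Min T + t) ` {..<k}"
        by (metis add.commute add.right_neutral image_add_atLeastLessThan lessThan_atLeast0)
      finally have "I = (\<lambda>t. (c + Min T + t) mod m) ` {..<k}"
        using IT by (metis (no_types, lifting) ab_semigroup_add_class.add_ac(1) image_cong image_image)
      then show ?thesis by blast
    qed
    ultimately show ?thesis by force
  qed
  then show "card I \<le> k" and "card I = k \<Longrightarrow> \<exists>a. I = (\<lambda>t. (a + t) mod m) ` {..<k}" by auto
qed

section \<open>Katona's double count\<close>

text \<open>A bijection from \<open>A\<close> to \<open>B\<close> is glued with one between the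
  complements, which also have equal size.\<close>

lemma ex_bij_mapping_subset:
  assumes "finite V" "A \<subseteq> V" "B \<subseteq> V" "card A = card B"
  shows "\<exists>p. bij_betw p V V \<and> p ` A = B"
proof -
  have fin: "finite A" "finite B" using assms finite_subset by auto
  obtain f where f: "bij_betw f A B"
    using finite_same_card_bij[OF fin assms(4)] by auto
  have "card (V - A) = card (V - B)"
    using assms fin by (simp add: card_Diff_subset)
  then obtain g where g: "bij_betw g (V - A) (V - B)"
    using finite_same_card_bij assms(1) by (metis finite_Diff)
  define p where "p x = (if x \<in> A then f x else g x)" for x
  have pA: "bij_betw p A B" using f by (subst bij_betw_cong[of _ _ f]) (auto simp: p_def)
  have pB: "bij_betw p (V - A) (V - B)"
    using g by (subst bij_betw_cong[of _ _ g]) (auto simp: p_def)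
  have "bij_betw p (A \<union> (V - A)) (B \<union> (V - B))"
    by (rule bij_betw_combine[OF pA pB]) auto
  moreover have "A \<union> (V - A) = V" "B \<union> (V - B) = V" using assms by auto
  ultimately show ?thesis using pA by (auto simp: bij_betw_def)
qed

text \<open>A permutation of \<open>V\<close> taking \<open>A\<close> to \<open>B\<close>, applied
  to every entry of an order, takes an occurrence of \<open>A\<close> to one of \<open>B\<close> at
  the same position. Exchanging \<open>A\<close> and \<open>B\<close> gives equality.\<close>

lemma card_arc_occurrences_le:
  assumes V: "finite V" "V \<noteq> {}" and AB: "A \<subseteq> V" "B \<subseteq> V" "card A = card B"
  shows "card {(xs, i). xs \<in> permutations_of_set V \<and> i < card V \<and> arc k xs i = A}
       \<le> card {(xs, i). xs \<in> permutations_of_set V \<and> i < card V \<and> arc k xs i = B}"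
    (is "card ?X \<le> card ?Y")
proof -
  obtain p where p: "bij_betw p V V" "p ` A = B"
    using ex_bij_mapping_subset[OF V(1) AB] by auto
  have "?Y \<subseteq> permutations_of_set V \<times> {..<card V}" by auto
  then have finY: "finite ?Y" by (rule finite_subset) auto
  have inj: "inj_on p V" using p by (auto simp: bij_betw_def)
  have "inj_on (\<lambda>(xs, i). (map p xs, i)) ?X"
  proof (rule inj_onI, clarsimp)
    fix xs ys assume "xs \<in> permutations_of_set V" "ys \<in> permutations_of_set V" "map p xs = map p ys"
    then show "xs = ys" using inj by (auto simp: permutations_of_set_def inj_on_map_eq_map)
  qed
  moreover have "(\<lambda>(xs, i). (map p xs, i)) ` ?X \<subseteq> ?Y"
  proof (clarsimp)
    fix xs i assume xs: "xs \<in> permutations_of_set V" and "i < card V" "A = arc k xs i"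
    moreover have "xs \<noteq> []" using xs V by (auto simp: permutations_of_set_def)
    ultimately show "map p xs \<in> permutations_of_set V \<and> arc k (map p xs) i = B"
      using p inj by (auto simp: permutations_of_set_def distinct_map bij_betw_def arc_map)
  qed
  ultimately show ?thesis using finY by (rule card_inj_on_le)
qed

text \<open>Pairs of an order and a position are grouped by the arc found there; by symmetry each
  \<open>k\<close>-set occurs equally often. One \<open>c\<close> serves all \<open>G\<close>, so a
  family can be compared with that of all \<open>k\<close>-subsets.\<close>

lemma sum_card_arcs:
  assumes V: "finite V" "V \<noteq> {}"
  shows "\<exists>c. \<forall>G. G \<subseteq> {A. A \<subseteq> V \<and> card A = k} \<longrightarrow>
    (\<Sum>xs\<in>permutations_of_set V. card {i. i < card V \<and> arc k xs i \<in> G}) = card G * c"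
proof (cases "\<exists>A. A \<subseteq> V \<and> card A = k")
  case False
  then have "G = {}" if "G \<subseteq> {A. A \<subseteq> V \<and> card A = k}" for G using that by auto
  \<comment> \<open>Only the empty \<open>G\<close> is possible here, so 0 is an arbitrary
    choice.\<close>
  then show ?thesis by (intro exI[of _ 0]) auto
next
  case True
  then obtain A where A: "A \<subseteq> V" "card A = k" by auto
  define occ where
    "occ B = {(xs, i). xs \<in> permutations_of_set V \<and> i < card V \<and> arc k xs i = B}" for B
  have "(\<Sum>xs\<in>permutations_of_set V. card {i. i < card V \<and> arc k xs i \<in> G}) = card G * card (occ A)"
    if G: "G \<subseteq> {A. A \<subseteq> V \<and> card A = k}" for G
  proof -
    have finG: "finite G" by (rule finite_subset[of _ "Pow V"]) (use G V in auto)
    have "finite (occ B)" for B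
      by (rule finite_subset[of _ "permutations_of_set V \<times> {..<card V}"]) (auto simp: occ_def)
    have "(\<Sum>xs\<in>permutations_of_set V. card {i. i < card V \<and> arc k xs i \<in> G})
        = card (SIGMA xs:permutations_of_set V. {i. i < card V \<and> arc k xs i \<in> G})"
      by (subst card_SigmaI) auto
    also have "(SIGMA xs:permutations_of_set V. {i. i < card V \<and> arc k xs i \<in> G}) = (\<Union>B\<in>G. occ B)"
      by (auto simp: occ_def)
    also have "card \<dots> = (\<Sum>B\<in>G. card (occ B))"
      using finG \<open>\<And>B. finite (occ B)\<close> by (subst card_UN_disjoint) (auto simp: occ_def)
    also have "\<dots> = (\<Sum>B\<in>G. card (occ A))"
      using G A unfolding occ_def
      by (intro sum.cong refl antisym card_arc_occurrences_le V) auto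
    finally show ?thesis by simp
  qed
  then show ?thesis by blast
qed

text \<open>The size condition is the one of \<open>cyclic_window\<close>; for a ground set of
  \<open>n + k - 1\<close> points it says exactly \<open>n \<ge> 2 * k\<close>.\<close>

locale intersecting_uniform_family =
  fixes V :: "'a set" and k :: nat and F :: "'a set set"
  assumes finite_V: "finite V" and k_pos: "k > 0" and card_V: "3 * k \<le> card V + 1"
    and F_subset: "F \<subseteq> {A. A \<subseteq> V \<and> card A = k}"
    and meet: "\<And>A B. A \<in> F \<Longrightarrow> B \<in> F \<Longrightarrow> A \<inter> B \<noteq> {}"
begin

definition starts :: "'a list \<Rightarrow> nat set" where
  "starts xs = {i. i < card V \<and> arc k xs i \<in> F}"

lemma V_nonempty: "V \<noteq> {}"
  using k_pos card_V by auto

lemma length_order: "xs \<in> permutations_of_set V \<Longrightarrow> length xs = card V"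
  by (auto simp: permutations_of_set_def distinct_card)

lemma order_nonempty: "xs \<in> permutations_of_set V \<Longrightarrow> xs \<noteq> []"
  using V_nonempty by (auto simp: permutations_of_set_def)

lemma starts_meet:
  assumes xs: "xs \<in> permutations_of_set V" and ij: "i \<in> starts xs" "j \<in> starts xs"
  shows "\<exists>s<k. \<exists>t<k. (i + s) mod card V = (j + t) mod card V"
proof -
  have "arc k xs i \<inter> arc k xs j \<noteq> {}" using ij meet by (auto simp: starts_def)
  then obtain s t where "s < k" "t < k" "xs ! ((i + s) mod length xs) = xs ! ((j + t) mod length xs)"
    by (auto simp: arc_def)
  moreover have "distinct xs" using xs by (auto simp: permutations_of_set_def)
  ultimately show ?thesis
    using length_order[OF xs] order_nonempty[OF xs] by (metis length_greater_0_conv mod_less_divisor nth_eq_iff_index_eq)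
qed

lemma card_starts_le:
  assumes "xs \<in> permutations_of_set V" shows "card (starts xs) \<le> k"
  by (rule cyclic_window(1)[of _ "card V"])
    (use starts_meet[OF assms] k_pos card_V in \<open>auto simp: starts_def\<close>)

lemma starts_window:
  assumes "xs \<in> permutations_of_set V" "card (starts xs) = k"
  shows "\<exists>a. starts xs = (\<lambda>t. (a + t) mod card V) ` {..<k}"
  by (rule cyclic_window(2)[of _ "card V"])
    (use starts_meet[OF assms(1)] assms(2) k_pos card_V in \<open>auto simp: starts_def\<close>)

text \<open>On average over all orders, \<open>F\<close> takes at most \<open>k\<close> of the
  \<open>card V\<close> positions, so it is at most the fraction \<open>k / card V\<close> of all
  \<open>k\<close>-subsets. If the bound is attained, no single order can fall short of
  \<open>k\<close>.\<close>

lemma family_bound: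
  "card F \<le> (card V - 1) choose (k - 1)"
  "card F = (card V - 1) choose (k - 1) \<Longrightarrow> xs \<in> permutations_of_set V \<Longrightarrow> card (starts xs) = k"
proof -
  define m where "m = card V"
  define N where "N = card (permutations_of_set V)"
  define S where "S = (\<Sum>xs\<in>permutations_of_set V. card (starts xs))"
  have m: "m > 0" using card_V k_pos unfolding m_def by auto
  have N: "N > 0" using finite_V by (simp add: N_def)
  obtain c where c: "\<And>G. G \<subseteq> {A. A \<subseteq> V \<and> card A = k} \<Longrightarrow>
      (\<Sum>xs\<in>permutations_of_set V. card {i. i < card V \<and> arc k xs i \<in> G}) = card G * c"
    using sum_card_arcs[OF finite_V V_nonempty, of k] by auto
  \<comment> \<open>Every arc is a \<open>k\<close>-subset of \<open>V\<close>, so the family of all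
    \<open>k\<close>-subsets takes all \<open>m\<close> positions of each order. This ties
    \<open>c\<close> to the number of orders.\<close>
  have "{i. i < card V \<and> arc k xs i \<subseteq> V \<and> card (arc k xs i) = k} = {..<m}"
    if "xs \<in> permutations_of_set V" for xs
    using that card_arc[of xs k] arc_subset[of xs k] order_nonempty[OF that] length_order[OF that] card_V
    by (auto simp: permutations_of_set_def m_def)
  then have "N * m = (m choose k) * c"
    using c[OF order_refl] n_subsets[OF finite_V, of k] by (simp add: N_def m_def)
  moreover have mk: "k * (m choose k) = m * ((m - 1) choose (k - 1))"
    using k_pos m times_binomial_minus1_eq by blast
  ultimately have "m * (N * k) = m * (((m - 1) choose (k - 1)) * c)"
    by (metis mult.assoc mult.commute)
  then have Nk: "N * k = ((m - 1) choose (k - 1)) * c" using m by simp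
  then have c0: "c > 0" using N k_pos by (metis gr0I mult_eq_0_iff not_gr0)
  have S: "S = card F * c" using c[OF F_subset] by (simp add: S_def starts_def)
  have "S \<le> (\<Sum>xs\<in>permutations_of_set V. k)"
    unfolding S_def by (intro sum_mono card_starts_le)
  then show "card F \<le> (card V - 1) choose (k - 1)"
    using S Nk c0 by (simp add: N_def m_def)
  assume eq: "card F = (card V - 1) choose (k - 1)" and xs: "xs \<in> permutations_of_set V"
  have "S = (\<Sum>xs\<in>permutations_of_set V. k)" using S Nk eq by (simp add: N_def m_def)
  then show "card (starts xs) = k"
    unfolding S_def using sum_mono_inv[OF _ card_starts_le xs] by simp
qed

end

section \<open>Families attaining the bound are stars\<close>

locale tight_family = intersecting_uniform_family +
  assumes tight: "card F = (card V - 1) choose (k - 1)"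
begin

lemma ex_starts_window:
  assumes "xs \<in> permutations_of_set V"
  shows "\<exists>a. starts xs = (\<lambda>t. (a + t) mod card V) ` {..<k}"
  using starts_window family_bound(2)[OF tight] assms by blast

text \<open>Two starts at distance \<open>k - 1\<close> can only be the two ends of the window of
  \<open>k\<close> starts.\<close>

lemma starts_eq_window:
  assumes xs: "xs \<in> permutations_of_set V" and ij: "i \<in> starts xs" "i + (k - 1) \<in> starts xs"
  shows "starts xs = (\<lambda>t. (i + t) mod card V) ` {..<k}"
proof -
  obtain a where a: "starts xs = (\<lambda>t. (a + t) mod card V) ` {..<k}"
    using ex_starts_window[OF xs] by blast
  obtain s t where st: "s < k" "t < k" "i = (a + s) mod card V" "i + (k - 1) = (a + t) mod card V"
    using ij unfolding a by auto
  then have "(a + s + (k - 1)) mod card V = (a + t) mod card V"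
    by (metis mod_add_left_eq mod_mod_trivial)
  then have "a + s + (k - 1) = a + t"
    by (rule eq_if_mod_eq) (use st card_V k_pos in auto)
  then have "s = 0" using st k_pos by simp
  then have "i = a mod card V" using st by simp
  then show ?thesis unfolding a by (simp add: mod_add_left_eq)
qed

text \<open>A window that contains 1 but not 0 begins at 1, hence its last position is
  \<open>k\<close>.\<close>

lemma starts_extend:
  assumes xs: "xs \<in> permutations_of_set V" and k: "k \<ge> 2" "k < card V"
    and "0 \<notin> starts xs" "1 \<in> starts xs"
  shows "k \<in> starts xs"
proof -
  obtain a where a: "starts xs = (\<lambda>t. (a + t) mod card V) ` {..<k}"
    using ex_starts_window[OF xs] by blast
  obtain s where s: "s < k" "1 = (a + s) mod card V" using assms(5) unfolding a by auto
  have "s = 0"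
  proof (rule ccontr)
    assume "s \<noteq> 0"
    then have "(a + (s - 1) + 1) mod card V = (0 + 1) mod card V" using s k by simp
    then have "(a + (s - 1)) mod card V = 0 mod card V"
      by (simp only: nat_mod_eq_iff) auto
    then have "(a + (s - 1)) mod card V = 0" by simp
    moreover have "s - 1 < k" using s by simp
    ultimately have "0 \<in> starts xs" unfolding a by (metis image_eqI lessThan_iff)
    then show False using assms(4) by simp
  qed
  then have "(a + (k - 1)) mod card V = (1 + (k - 1)) mod card V"
    using s by (metis add.right_neutral mod_add_left_eq)
  then have "(a + (k - 1)) mod card V = k" using k by simp
  then show ?thesis unfolding a using k by (intro image_eqI[of _ _ "k - 1"]) auto
qed

lemma ex_order_append:
  assumes "distinct us" "set us \<subseteq> V"
  shows "\<exists>vs. us @ vs \<in> permutations_of_set V"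
proof -
  obtain vs where "set vs = V - set us" "distinct vs"
    using finite_distinct_list finite_V by (metis finite_Diff)
  then show ?thesis using assms by (intro exI[of _ vs]) (auto simp: permutations_of_set_def)
qed

text \<open>Order \<open>A \<union> B\<close> linearly as \<open>A - {x}\<close>, \<open>x\<close>, \<open>B - {x, b}\<close>, \<open>b\<close>, preceded by a point \<open>z\<close>
  outside. The arcs from \<open>A\<close> to \<open>B\<close> are then exactly the ones in the family. Putting \<open>y\<close> in
  the place of \<open>b\<close> keeps all of them but the last, and the arc starting at \<open>z\<close> stays outside, so
  the new last arc has to be in the family.\<close>

lemma exchange:
  assumes A: "A \<in> F" and B: "B \<in> F" and AB: "A \<inter> B = {x}"
    and b: "b \<in> B" "b \<noteq> x" and y: "y \<in> V" "y \<notin> A \<union> B"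
  shows "insert y (B - {b}) \<in> F"
proof -
  have AV: "A \<subseteq> V" "card A = k" "B \<subseteq> V" "card B = k" using A B F_subset by auto
  have fin: "finite A" "finite B" using AV finite_V finite_subset by auto
  have xAB: "x \<in> A" "x \<in> B" using AB by auto
  have "card {x, b} \<le> card B" using b xAB fin by (intro card_mono) auto
  then have k2: "k \<ge> 2" using b AV by simp
  have bA: "b \<notin> A" using b AB by blast
  \<comment> \<open>Together with \<open>y\<close> these are \<open>2 * k\<close> points, fewer than
    \<open>3 * k - 1\<close> because \<open>k \<ge> 2\<close>, so a point \<open>z\<close> is left
    over.\<close>
  have "card (A \<union> B) + 1 = 2 * k" using card_Un_Int[OF fin] AB AV by simp
  then have "card (insert y (A \<union> B)) = 2 * k" using y fin by simp
  then have "card (insert y (A \<union> B)) < card V" using card_V k2 by simp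
  then have "\<not> V \<subseteq> insert y (A \<union> B)" using fin card_mono
    by (metis finite.insertI finite_UnI not_le)
  then obtain z where z: "z \<in> V" "z \<noteq> y" "z \<notin> A \<union> B" by auto
  obtain as where as: "set as = A - {x}" "distinct as"
    using finite_distinct_list fin by (metis finite_Diff)
  obtain bs where bs: "set bs = B - {x, b}" "distinct bs"
    using finite_distinct_list fin by (metis finite_Diff)
  have las: "length as = k - 1" using as AV xAB fin by (metis card_Diff_singleton distinct_card)
  have "card (B - {x, b}) = k - 2" using AV xAB b fin by (subst card_Diff_subset) auto
  then have lbs: "length bs = k - 2" using bs by (metis distinct_card)
  \<comment> \<open>The common beginning of both orders; the next entry is \<open>b\<close> in one
    and \<open>y\<close> in the other. Position 0 holds \<open>z\<close>, the positions 1 to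
    \<open>k - 1\<close> hold \<open>A - {x}\<close>, and position \<open>k\<close> holds
    \<open>x\<close>.\<close>
  define ws where "ws = z # as @ x # bs"
  have dws: "distinct ws" "set ws \<subseteq> V" using as bs z AV xAB AB by (auto simp: ws_def)
  have ex: "\<exists>vs. ws @ u # vs \<in> permutations_of_set V" if "u \<in> V" "u \<notin> set ws" for u
    using ex_order_append[of "ws @ [u]"] that dws by auto
  have bV: "b \<in> V" "b \<notin> set ws" using b bA z as bs AV by (auto simp: ws_def)
  have yV: "y \<in> V" "y \<notin> set ws" using y z as bs xAB by (auto simp: ws_def)
  obtain vs where vs: "ws @ b # vs \<in> permutations_of_set V"
    using ex[of b] bV by blast
  obtain vs' where vs': "ws @ y # vs' \<in> permutations_of_set V"
    using ex[of y] yV by blast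
  have kV: "2 * k < card V" using card_V k2 by simp
  have arc0: "arc k (ws @ u # us) 0 = insert z (A - {x})" for u us
    using arc_append[of "[]" 0 "z # as" k "x # bs @ u # us"] las as k_pos by (simp add: ws_def)
  have arc1: "arc k (ws @ u # us) 1 = A" for u us
    using arc_append[of "[z]" 1 "as @ [x]" k "bs @ u # us"] las as k_pos xAB
    by (simp add: ws_def insert_absorb)
  have arck: "arc k (ws @ u # us) k = insert u (B - {b})" for u us
  proof -
    have "arc k (ws @ u # us) k = set (x # bs @ [u])"
      using arc_append[of "z # as" k "x # bs @ [u]" k us] las lbs k2 by (simp add: ws_def)
    then show ?thesis using bs xAB b by auto
  qed
  have st: "starts (ws @ b # vs) = (\<lambda>t. (1 + t) mod card V) ` {..<k}"
    by (rule starts_eq_window[OF vs])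
      (use arc1 arck A B b kV k2 in \<open>auto simp: starts_def insert_absorb simp del: One_nat_def\<close>)
  have "0 \<notin> starts (ws @ b # vs)"
    using kV unfolding st by auto
  then have "insert z (A - {x}) \<notin> F" using arc0 kV by (auto simp: starts_def)
  then have "k \<in> starts (ws @ y # vs')"
    using arc0 arc1 A kV k2 by (intro starts_extend[OF vs']) (auto simp: starts_def simp del: One_nat_def)
  then show ?thesis using arck by (simp add: starts_def)
qed

text \<open>\<open>B\<close> is moved to \<open>D\<close> one element at a time; every intermediate
  set meets \<open>A\<close> exactly in \<open>x\<close>, so \<open>exchange\<close> applies
  again.\<close>

lemma exchange_all:
  assumes A: "A \<in> F" and "B \<in> F" "A \<inter> B = {x}"
    and D: "D \<subseteq> V" "card D = k" "A \<inter> D = {x}"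
  shows "D \<in> F"
  using assms(2,3)
proof (induction "card (D - B)" arbitrary: B)
  case 0
  have "B \<subseteq> V" "card B = k" using F_subset 0 by auto
  then have "finite D" "finite B" "card B = k" using D(1) finite_subset[OF _ finite_V] by auto
  moreover have "D \<subseteq> B" using 0 \<open>finite D\<close> by auto
  ultimately have "D = B" using D by (intro card_subset_eq) auto
  then show ?case using 0 by simp
next
  case (Suc j)
  have fin: "finite D" "finite B" "card B = k" "B \<subseteq> V"
    using D(1) F_subset Suc.prems finite_subset[OF _ finite_V] by auto
  obtain y where y: "y \<in> D" "y \<notin> B" using Suc.hyps(2)
    by (metis Diff_eq_empty_iff card.empty nat.distinct(1) subsetI)
  then have "\<not> B \<subseteq> D" using fin D by (metis card_subset_eq)
  then obtain b where b: "b \<in> B" "b \<notin> D" by auto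
  define C where "C = insert y (B - {b})"
  \<comment> \<open>Here \<open>b \<noteq> x\<close> because \<open>x \<in> D\<close>, and
    \<open>y \<notin> A\<close> because \<open>A \<inter> D = {x}\<close> while
    \<open>x \<in> B\<close>.\<close>
  have "C \<in> F" unfolding C_def
    by (rule exchange[OF A Suc.prems]) (use y b D Suc.prems in auto)
  moreover have "A \<inter> C = {x}" using y b D Suc.prems by (auto simp: C_def)
  moreover have "D - C = (D - B) - {y}" using y b by (auto simp: C_def)
  then have "j = card (D - C)" using Suc.hyps(2) y fin by (simp add: card_Diff_singleton)
  ultimately show ?case using Suc.hyps(1) by blast
qed

lemma card_star:
  assumes "x \<in> V"
  shows "card {D. D \<subseteq> V \<and> card D = k \<and> x \<in> D} = (card V - 1) choose (k - 1)"
proof -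
  have "{D. D \<subseteq> V \<and> card D = k \<and> x \<in> D} = insert x ` {D. D \<subseteq> V - {x} \<and> card D = k - 1}"
    (is "?L = ?R")
  proof
    show "?L \<subseteq> ?R"
    proof
      fix D assume D: "D \<in> ?L"
      then have "finite D" using finite_V finite_subset by auto
      then show "D \<in> ?R" using D by (intro image_eqI[of _ _ "D - {x}"]) auto
    qed
    show "?R \<subseteq> ?L"
    proof
      fix E assume "E \<in> ?R"
      then obtain D where D: "D \<subseteq> V - {x}" "card D = k - 1" "E = insert x D" by auto
      then have "finite D" "x \<notin> D" using finite_subset[OF _ finite_V, of D] by auto
      then show "E \<in> ?L" using D assms k_pos by auto
    qed
  qed
  moreover have "inj_on (insert x) {D. D \<subseteq> V - {x} \<and> card D = k - 1}"
    by (rule inj_onI) blast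
  moreover have "card {D. D \<subseteq> V - {x} \<and> card D = k - 1} = (card V - 1) choose (k - 1)"
    using n_subsets[of "V - {x}" "k - 1"] finite_V assms by simp
  ultimately show ?thesis by (simp add: card_image)
qed

text \<open>The centre \<open>x\<close> is the only common point of the first and last arc of a
  window. A \<open>k\<close>-set \<open>D\<close> through \<open>x\<close> may meet \<open>A\<close>
  elsewhere too, so it is reached by way of a third set that meets both \<open>A\<close> and
  \<open>D\<close> only in \<open>x\<close>. Equal cardinality then leaves no room for sets outside
  the star.\<close>

theorem family_is_star: "\<exists>x\<in>V. F = {D. D \<subseteq> V \<and> card D = k \<and> x \<in> D}"
proof -
  obtain xs where xs: "xs \<in> permutations_of_set V"
    using ex_order_append[of "[]"] by auto
  obtain a where a: "starts xs = (\<lambda>t. (a + t) mod card V) ` {..<k}"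
    using ex_starts_window[OF xs] by blast
  define A B where "A = arc k xs (a mod card V)" and "B = arc k xs ((a + (k - 1)) mod card V)"
  define x where "x = xs ! ((a + (k - 1)) mod card V)"
  have len: "length xs = card V" and dist: "distinct xs" and set: "set xs = V"
    using xs length_order by (auto simp: permutations_of_set_def)
  have V0: "card V > 0" using card_V k_pos by simp
  have "(a + 0) mod card V \<in> starts xs" "(a + (k - 1)) mod card V \<in> starts xs"
    unfolding a using k_pos by (intro imageI, simp)+
  then have A: "A \<in> F" and B: "B \<in> F" by (auto simp: starts_def A_def B_def)
  \<comment> \<open>Places in the two arcs are less than \<open>card V\<close> apart, so only the
    last point of \<open>A\<close> and the first of \<open>B\<close> coincide.\<close>
  have AB: "A \<inter> B = {x}"
  proof
    show "{x} \<subseteq> A \<inter> B"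
    proof -
      have "x \<in> A" unfolding A_def x_def arc_def len mod_add_left_eq
        using k_pos by (intro image_eqI[of _ _ "k - 1"]) auto
      moreover have "x \<in> B" unfolding B_def x_def arc_def len mod_add_left_eq
        using k_pos by (intro image_eqI[of _ _ 0]) auto
      ultimately show ?thesis by simp
    qed
    show "A \<inter> B \<subseteq> {x}"
    proof
      fix w assume "w \<in> A \<inter> B"
      then obtain s t where st: "s < k" "t < k" "w = xs ! ((a + s) mod card V)"
          "xs ! ((a + s) mod card V) = xs ! ((a + (k - 1) + t) mod card V)"
        by (auto simp: A_def B_def arc_def len mod_add_left_eq)
      then have "(a + s) mod card V = (a + (k - 1) + t) mod card V"
        using dist len V0 by (simp add: nth_eq_iff_index_eq)
      then have "a + s = a + (k - 1) + t"
        by (rule eq_if_mod_eq) (use st card_V k_pos in auto)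
      then have "s = k - 1" using st by auto
      then show "w \<in> {x}" using st by (simp add: x_def)
    qed
  qed
  have AV: "A \<subseteq> V" "card A = k" using A F_subset by auto
  then have xV: "x \<in> V" using AB by auto
  have "D \<in> F" if D: "D \<subseteq> V" "card D = k" "x \<in> D" for D
  proof -
    have fin: "finite A" "finite D" using AV D finite_V finite_subset by auto
    have "card (A \<inter> D) \<ge> 1" using fin D AB by (metis IntI Int_iff One_nat_def Suc_leI card_gt_0_iff empty_iff finite_Int insertI1)
    \<comment> \<open>At least \<open>3 * k - 1 - (2 * k - 1) = k\<close> points lie outside
      \<open>A \<union> D\<close>, enough for \<open>E\<close>.\<close>
    then have "card (A \<union> D) \<le> 2 * k - 1" using card_Un_Int[OF fin] AV D by simp
    then have "k - 1 \<le> card (V - (A \<union> D))"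
      using card_V k_pos fin D AV by (subst card_Diff_subset) auto
    then obtain E where E: "E \<subseteq> V - (A \<union> D)" "card E = k - 1"
      by (metis obtain_subset_with_card_n)
    have finE: "finite E" using E finite_V finite_subset by (metis finite_Diff)
    have xA: "x \<in> A" using AB by auto
    have "insert x E \<in> F"
      by (rule exchange_all[OF A B AB]) (use E xV xA finE k_pos in \<open>auto simp: card_insert_if\<close>)
    moreover have "insert x E \<inter> A = {x}" using E xA by auto
    moreover have "insert x E \<inter> D = {x}" using E D by auto
    ultimately show ?thesis using exchange_all[of "insert x E" A x D] A D by simp
  qed
  then have "{D. D \<subseteq> V \<and> card D = k \<and> x \<in> D} \<subseteq> F" by auto
  moreover have "finite F" by (rule finite_subset[of _ "Pow V"]) (use F_subset finite_V in auto)
  ultimately have "{D. D \<subseteq> V \<and> card D = k \<and> x \<in> D} = F"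
    using card_star[OF xV] tight by (intro card_subset_eq) auto
  then show ?thesis using xV by blast
qed

end

section \<open>Multisets as subsets of a larger ground set\<close>

lemma k_multisets_eq: "k_multisets n k = multisets_of_size {1..n} k"
  by (simp add: k_multisets_def multisets_of_size_def)

lemma finite_k_multisets: "finite (k_multisets n k)"
  by (simp add: k_multisets_eq finite_multisets_of_size)

text \<open>Removing one copy of \<open>x\<close> leaves an arbitrary multiset of size
  \<open>k - 1\<close>.\<close>

lemma card_trivial_collection:
  assumes "trivial_collection n k \<M>" "k > 0"
  shows "card \<M> = (n + k - 2) choose (k - 1)"
proof -
  obtain x where x: "x \<in> {1..n}" "\<M> = {A \<in> k_multisets n k. x \<in># A}"
    using assms by (auto simp: trivial_collection_def)
  have "\<M> = add_mset x ` multisets_of_size {1..n} (k - 1)"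
  proof
    show "\<M> \<subseteq> add_mset x ` multisets_of_size {1..n} (k - 1)"
    proof
      fix A assume A: "A \<in> \<M>"
      then obtain B where "A = add_mset x B" using x by (auto dest: multi_member_split)
      then show "A \<in> add_mset x ` multisets_of_size {1..n} (k - 1)"
        using A x by (auto simp: k_multisets_def multisets_of_size_def)
    qed
    show "add_mset x ` multisets_of_size {1..n} (k - 1) \<subseteq> \<M>"
      using x assms(2) by (auto simp: k_multisets_def multisets_of_size_def)
  qed
  then have "card \<M> = card (multisets_of_size {1..n} (k - 1))"
    by (simp add: card_image inj_on_def)
  then show ?thesis using x assms(2) by (simp add: card_multisets_of_size numeral_2_eq_2)
qed

text \<open>Removing one copy of each element of \<open>S\<close> leaves an arbitrary multiset on
  \<open>S\<close> of size \<open>k - card S\<close>. For empty \<open>S\<close> both sides are 0,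
  as \<open>k > 0\<close>.\<close>

lemma card_multisets_with_support:
  assumes "finite S" "card S \<le> k" "k > 0"
  shows "card {M. set_mset M = S \<and> size M = k} = (k - 1) choose (k - card S)"
proof -
  have "{M. set_mset M = S \<and> size M = k} = (+) (mset_set S) ` multisets_of_size S (k - card S)"
    (is "?L = ?R")
  proof
    show "?L \<subseteq> ?R"
    proof
      fix M assume M: "M \<in> ?L"
      then have "mset_set S \<subseteq># M" using mset_set_set_mset_msubset by blast
      then obtain N where "M = mset_set S + N" by (auto simp: subset_mset.le_iff_add)
      then show "M \<in> ?R" using M assms(1) by (auto simp: multisets_of_size_def)
    qed
    show "?R \<subseteq> ?L" using assms by (auto simp: multisets_of_size_def)
  qed
  then have "card {M. set_mset M = S \<and> size M = k} = card (multisets_of_size S (k - card S))"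
    by (simp add: card_image)
  then show ?thesis using assms by (simp add: card_multisets_of_size)
qed

text \<open>Each choice of \<open>k - card S\<close> points of \<open>W\<close> completes
  \<open>S\<close> to such a set.\<close>

lemma card_subsets_with_trace_ge:
  assumes "finite U" "finite W" "U \<inter> W = {}" "S \<subseteq> U" "card S \<le> k"
  shows "(card W) choose (k - card S) \<le> card {A. A \<subseteq> U \<union> W \<and> card A = k \<and> A \<inter> U = S}"
proof -
  have finS: "finite S" using assms finite_subset by auto
  have "inj_on ((\<union>) S) {T. T \<subseteq> W \<and> card T = k - card S}"
    by (rule inj_onI) (use assms in blast)
  moreover have "(\<union>) S ` {T. T \<subseteq> W \<and> card T = k - card S}
      \<subseteq> {A. A \<subseteq> U \<union> W \<and> card A = k \<and> A \<inter> U = S}"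
  proof clarify
    fix T assume T: "T \<subseteq> W" "card T = k - card S"
    then have "finite T" "S \<inter> T = {}" using assms finite_subset by auto
    then have "card (S \<union> T) = k" using T finS assms(5) by (simp add: card_Un_disjoint)
    then show "S \<union> T \<subseteq> U \<union> W \<and> card (S \<union> T) = k \<and> (S \<union> T) \<inter> U = S" using T assms by auto
  qed
  ultimately have "card {T. T \<subseteq> W \<and> card T = k - card S}
      \<le> card {A. A \<subseteq> U \<union> W \<and> card A = k \<and> A \<inter> U = S}"
    by (rule card_inj_on_le) (use assms in auto)
  then show ?thesis by (simp add: n_subsets[OF assms(2)])
qed

text \<open>With \<open>k - 1\<close> additional points both counts involve the same binomial
  coefficient, so an injection exists for each support. These glue together because the trace of
  \<open>f M\<close> determines the support of \<open>M\<close>.\<close>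

lemma ex_support_preserving_injection:
  assumes "k > 0"
  shows "\<exists>f. inj_on f (k_multisets n k) \<and>
    (\<forall>M\<in>k_multisets n k. f M \<subseteq> {1..n + k - 1} \<and> card (f M) = k \<and> f M \<inter> {1..n} = set_mset M)"
proof -
  define P where "P S = {M. set_mset M = S \<and> size M = k}" for S :: "nat set"
  define Q where "Q S = {A. A \<subseteq> {1..n + k - 1} \<and> card A = k \<and> A \<inter> {1..n} = S}" for S
  have "\<exists>g. inj_on g (P S) \<and> g ` P S \<subseteq> Q S" if S: "S \<subseteq> {1..n}" for S
  proof (cases "card S \<le> k")
    case True
    have finS: "finite S" using S finite_subset by auto
    have "P S \<subseteq> multisets_of_size S k" by (auto simp: P_def multisets_of_size_def)
    then have "finite (P S)" using finite_multisets_of_size[OF finS] finite_subset by auto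
    moreover have "finite (Q S)" by (simp add: Q_def)
    moreover have "{1..n} \<union> {n + 1..n + k - 1} = {1..n + k - 1}" using assms by auto
    then have "card (P S) \<le> card (Q S)"
      using card_multisets_with_support[OF finS True assms]
        card_subsets_with_trace_ge[of "{1..n}" "{n + 1..n + k - 1}" S k] S True
      by (simp add: P_def Q_def)
    ultimately show ?thesis using card_le_inj by blast
  next
    case False
    have "card (set_mset M) \<le> size M" for M :: "nat multiset"
      using size_mset_mono[OF mset_set_set_mset_msubset[of M]] by simp
    then have "P S = {}" using False by (auto simp: P_def)
    then show ?thesis by simp
  qed
  then obtain g where g: "\<And>S. S \<subseteq> {1..n} \<Longrightarrow> inj_on (g S) (P S) \<and> g S ` P S \<subseteq> Q S"
    by metis
  define f where "f M = g (set_mset M) M" for M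
  have f: "f M \<in> Q (set_mset M)" if "M \<in> k_multisets n k" for M
    using g[of "set_mset M"] that by (auto simp: f_def P_def k_multisets_def)
  have "inj_on f (k_multisets n k)"
  proof (rule inj_onI)
    fix M N assume M: "M \<in> k_multisets n k" and N: "N \<in> k_multisets n k" and eq: "f M = f N"
    then have supp: "set_mset M = set_mset N" using f[OF M] f[OF N] by (simp add: Q_def)
    moreover have "inj_on (g (set_mset M)) (P (set_mset M))"
      using g M by (simp add: k_multisets_def)
    ultimately show "M = N"
      using M N eq by (auto simp: f_def P_def k_multisets_def dest: inj_onD)
  qed
  then show ?thesis using f unfolding Q_def by (intro exI[of _ f]) blast
qed

section \<open>From families of sets back to multisets\<close>

theorem theorem3p2:
  fixes n k :: nat
  assumes "n > 0" and "k > 0" and "n \<ge> 2 * k"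
  shows "(\<forall>\<M>. \<M> \<subseteq> k_multisets n k \<and> intersecting \<M> \<longrightarrow>
            card \<M> \<le> (n + k - 2) choose (k - 1) \<and>
            (card \<M> = (n + k - 2) choose (k - 1) \<longleftrightarrow> trivial_collection n k \<M>)) \<and>
         (\<exists>\<M>. \<M> \<subseteq> k_multisets n k \<and> intersecting \<M> \<and>
            card \<M> = (n + k - 2) choose (k - 1))"
proof (intro conjI allI impI)
  define \<T> where "\<T> = {A \<in> k_multisets n k. 1 \<in># A}"
  have "trivial_collection n k \<T>"
    using assms by (auto simp: trivial_collection_def \<T>_def intro!: bexI[of _ 1])
  moreover have "\<T> \<subseteq> k_multisets n k" "intersecting \<T>"
    by (auto simp: \<T>_def intersecting_def simp flip: set_mset_eq_empty_iff)
  ultimately show "\<exists>\<M>. \<M> \<subseteq> k_multisets n k \<and> intersecting \<M> \<and>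
      card \<M> = (n + k - 2) choose (k - 1)"
    using card_trivial_collection[OF _ assms(2)] by blast
next
  fix \<M> assume \<M>: "\<M> \<subseteq> k_multisets n k \<and> intersecting \<M>"
  obtain f where inj: "inj_on f (k_multisets n k)"
    and f: "\<And>M. M \<in> k_multisets n k \<Longrightarrow>
      f M \<subseteq> {1..n + k - 1} \<and> card (f M) = k \<and> f M \<inter> {1..n} = set_mset M"
    using ex_support_preserving_injection[OF assms(2)] by metis
  \<comment> \<open>The images meet even inside \<open>{1..n}\<close>; this later keeps the centre
    of the star from being an additional point.\<close>
  have traces_meet: "f M \<inter> f N \<inter> {1..n} \<noteq> {}" if "M \<in> \<M>" "N \<in> \<M>" for M N
  proof -
    have "set_mset M \<inter> set_mset N \<noteq> {}"
      using \<M> that by (auto simp: intersecting_def simp flip: set_mset_eq_empty_iff)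
    then show ?thesis using f[of M] f[of N] that \<M> by blast
  qed
  interpret intersecting_uniform_family "{1..n + k - 1}" k "f ` \<M>"
  proof
    show "f ` \<M> \<subseteq> {A. A \<subseteq> {1..n + k - 1} \<and> card A = k}" using f \<M> by blast
    show "A \<inter> B \<noteq> {}" if "A \<in> f ` \<M>" "B \<in> f ` \<M>" for A B using traces_meet that by blast
  qed (use assms in auto)
  have card_f: "card (f ` \<M>) = card \<M>" using inj \<M> by (meson card_image inj_on_subset)
  show "card \<M> \<le> (n + k - 2) choose (k - 1)"
    using family_bound(1) card_f by (simp add: numeral_2_eq_2)
  show "card \<M> = (n + k - 2) choose (k - 1) \<longleftrightarrow> trivial_collection n k \<M>"
  proof
    assume eq: "card \<M> = (n + k - 2) choose (k - 1)"
    interpret tight_family "{1..n + k - 1}" k "f ` \<M>"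
      by unfold_locales (simp add: eq card_f numeral_2_eq_2)
    obtain x where x: "x \<in> {1..n + k - 1}"
      and star: "f ` \<M> = {D. D \<subseteq> {1..n + k - 1} \<and> card D = k \<and> x \<in> D}"
      using family_is_star by blast
    have "x \<le> n"
    proof (rule ccontr)
      \<comment> \<open>Since \<open>2 * k \<le> n\<close>, the star would contain two sets whose
        only common point \<open>x\<close> lies outside \<open>{1..n}\<close>.\<close>
      assume "\<not> x \<le> n"
      define A B where "A = insert x {1..k - 1}" and "B = insert x {k..2 * k - 2}"
      have "card A = k" "card B = k" using \<open>\<not> x \<le> n\<close> assms by (auto simp: A_def B_def card_insert_if)
      moreover have "A \<subseteq> {1..n + k - 1}" "B \<subseteq> {1..n + k - 1}"
        using x assms by (auto simp: A_def B_def)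
      ultimately have "A \<in> f ` \<M>" "B \<in> f ` \<M>" unfolding star by (auto simp: A_def B_def)
      then have "A \<inter> B \<inter> {1..n} \<noteq> {}" using traces_meet by (elim imageE) simp
      then show False using \<open>\<not> x \<le> n\<close> by (auto simp: A_def B_def)
    qed
    then have xn: "x \<in> {1..n}" using x by simp
    define \<T> where "\<T> = {A \<in> k_multisets n k. x \<in># A}"
    have T: "trivial_collection n k \<T>" using xn by (auto simp: trivial_collection_def \<T>_def)
    have "\<M> \<subseteq> \<T>"
    proof
      fix M assume M: "M \<in> \<M>"
      then have "x \<in> f M" using star by blast
      moreover have Mk: "M \<in> k_multisets n k" using M \<M> by blast
      ultimately have "x \<in> set_mset M" using f[OF Mk] xn by blast
      then show "M \<in> \<T>" using Mk by (simp add: \<T>_def)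
    qed
    moreover have "finite \<T>" using finite_k_multisets by (simp add: \<T>_def)
    moreover have "card \<M> = card \<T>" using eq card_trivial_collection[OF T assms(2)] by simp
    ultimately have "\<M> = \<T>" by (simp add: card_subset_eq)
    then show "trivial_collection n k \<M>" using T by simp
  qed (rule card_trivial_collection[OF _ assms(2)])
qed

end
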